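(* Let $A$ be a vector space over $\mathbb{C}$ with a bilinear multiplication $\cdot:A\times A\to A$, and let $x\circ y:=x\cdot y+y\cdot x$. Suppose that for all $x,y,z,u\in A$, $$(x\circ y)\cdot(z\cdot u)+(y\circ z)\cdot(x\cdot u)+(z\circ x)\cdot(y\cdot u)=x\cdot(y\cdot(z\cdot u))+z\cdot(y\cdot(x\cdot u))+((x\circ z)\circ y)\cdot u.$$ Then $(A,\cdot)$ is a pre-Jordan algebra if and only if $(A,\circ)$ is a Jordan algebra.
   Context: A Jordan algebra is a vector space $J$ with a commutative bilinear multiplication $\circ$ satisfying $((x\circ x)\circ y)\circ x=(x\circ x)\circ(y\circ x)$ for all $x,y\in J$. A pre-Jordan algebra is a vector space $A$ with a bilinear multiplication $\cdot$ such that, writing $x\circ y:=x\cdot y+y\cdot x$, for all $x,y,z,u\in A$: $$(x\circ y)\cdot(z\cdot u)+(y\circ z)\cdot(x\cdot u)+(z\circ x)\cdot(y\cdot u)= x\cdot(y\cdot(z\cdot u))+z\cdot(y\cdot(x\cdot u))+((x\circ z)\circ y)\cdot u= z\cdot((x\circ y)\cdot u)+x\cdot((y\circ z)\cdot u)+y\cdot((z\circ x)\cdot u).$$ *)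

theory Defs
  imports Complex_Main
begin

locale bilinear_algebra = vector_space scale
  for scale :: "'k::field \<Rightarrow> 'a::ab_group_add \<Rightarrow> 'a" +
  fixes mult :: "'a \<Rightarrow> 'a \<Rightarrow> 'a"
  assumes linear_right: "Vector_Spaces.linear scale scale (\<lambda>y. mult x y)"
    and linear_left: "Vector_Spaces.linear scale scale (\<lambda>x. mult x y)"

locale jordan_algebra = bilinear_algebra scale mult
  for scale :: "'k::field \<Rightarrow> 'a::ab_group_add \<Rightarrow> 'a"
    and mult :: "'a \<Rightarrow> 'a \<Rightarrow> 'a" (infixl "\<odot>" 70) +
  assumes commutative: "x \<odot> y = y \<odot> x"
    and jordan_identity: "((x \<odot> x) \<odot> y) \<odot> x = (x \<odot> x) \<odot> (y \<odot> x)"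

text \<open>No factor 1/2 is included, following the convention for pre-Jordan algebras.\<close>

definition anticommutator :: "('a::plus \<Rightarrow> 'a \<Rightarrow> 'a) \<Rightarrow> 'a \<Rightarrow> 'a \<Rightarrow> 'a" where
  "anticommutator mult x y = mult x y + mult y x"

locale pre_jordan_algebra = bilinear_algebra scale mult
  for scale :: "'k::field \<Rightarrow> 'a::ab_group_add \<Rightarrow> 'a"
    and mult :: "'a \<Rightarrow> 'a \<Rightarrow> 'a" (infixl "\<cdot>" 70) +
  fixes circ :: "'a \<Rightarrow> 'a \<Rightarrow> 'a" (infixl "\<circ>\<^sub>J" 70)
  defines "circ \<equiv> anticommutator (\<cdot>)"
  assumes pre_jordan_1:
    "(x \<circ>\<^sub>J y) \<cdot> (z \<cdot> u) + (y \<circ>\<^sub>J z) \<cdot> (x \<cdot> u) + (z \<circ>\<^sub>J x) \<cdot> (y \<cdot> u)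
     = x \<cdot> (y \<cdot> (z \<cdot> u)) + z \<cdot> (y \<cdot> (x \<cdot> u)) + ((x \<circ>\<^sub>J z) \<circ>\<^sub>J y) \<cdot> u"
    and pre_jordan_2:
    "x \<cdot> (y \<cdot> (z \<cdot> u)) + z \<cdot> (y \<cdot> (x \<cdot> u)) + ((x \<circ>\<^sub>J z) \<circ>\<^sub>J y) \<cdot> u
     = z \<cdot> ((x \<circ>\<^sub>J y) \<cdot> u) + x \<cdot> ((y \<circ>\<^sub>J z) \<cdot> u) + y \<cdot> ((z \<circ>\<^sub>J x) \<cdot> u)"

end

theory Submission imports Defs begin

text \<open>
  Write \<open>L(x)\<close> for left multiplication by \<open>x\<close> and \<open>x \<circ> y = x \<cdot> y + y \<cdot> x\<close>. Measure the failure of the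
  three identities involved by the defects
  \<^item> \<open>P(x,y,z) = L(x\<circ>y) L(z) + L(y\<circ>z) L(x) + L(z\<circ>x) L(y) - L(x) L(y) L(z) - L(z) L(y) L(x) - L((x\<circ>z)\<circ>y)\<close>,
    which vanishes exactly when the first pre-Jordan identity holds;
  \<^item> \<open>Q(x,y,z) = [L(x\<circ>y), L(z)] + [L(y\<circ>z), L(x)] + [L(z\<circ>x), L(y)]\<close>, whose vanishing equates the
    first and the last member of the pre-Jordan axioms;
  \<^item> \<open>J(x,y,z;u)\<close>, the full linearization of the Jordan identity for \<open>\<circ>\<close>.

  Expand \<open>J(x,y,z;u)\<close> into words in \<open>\<cdot>\<close> and sort these by their last letter. The words ending in \<open>u\<close>
  add up to \<open>Q(x,y,z) u\<close>, and those ending in \<open>z\<close> add up to \<open>P(x,u,y) z\<close>; the letters \<open>x\<close> and \<open>y\<close>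
  behave as \<open>z\<close> does. So \<open>J(x,y,z;u) = Q(x,y,z) u + P(x,u,y) z + P(y,u,z) x + P(z,u,x) y\<close>
  (lemma \<open>jordan_defect_decomposition\<close>). Once \<open>P = 0\<close>, this reads \<open>J = Q\<close>, so the second pre-Jordan
  identity is equivalent to the linearized Jordan identity. The latter is equivalent to the Jordan
  identity itself by polarization, as \<open>6\<close> is invertible (lemma \<open>jordan_identity_iff_linearized\<close>).
\<close>

definition pre_jordan_defect :: "('a::ab_group_add \<Rightarrow> 'a \<Rightarrow> 'a) \<Rightarrow> 'a \<Rightarrow> 'a \<Rightarrow> 'a \<Rightarrow> 'a \<Rightarrow> 'a" where
  "pre_jordan_defect m x y z u = (let c = anticommutator m in
     m (c x y) (m z u) + m (c y z) (m x u) + m (c z x) (m y u)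
     - m x (m y (m z u)) - m z (m y (m x u)) - m (c (c x z) y) u)"

definition commutator_defect :: "('a::ab_group_add \<Rightarrow> 'a \<Rightarrow> 'a) \<Rightarrow> 'a \<Rightarrow> 'a \<Rightarrow> 'a \<Rightarrow> 'a \<Rightarrow> 'a" where
  "commutator_defect m x y z u = (let c = anticommutator m in
     m (c x y) (m z u) + m (c y z) (m x u) + m (c z x) (m y u)
     - m z (m (c x y) u) - m x (m (c y z) u) - m y (m (c z x) u))"

definition jordan_defect :: "('a::ab_group_add \<Rightarrow> 'a \<Rightarrow> 'a) \<Rightarrow> 'a \<Rightarrow> 'a \<Rightarrow> 'a \<Rightarrow> 'a \<Rightarrow> 'a" where
  "jordan_defect c x y z u =
     c (c x y) (c z u) + c (c y z) (c x u) + c (c z x) (c y u)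
     - c (c (c x y) u) z - c (c (c y z) u) x - c (c (c z x) u) y"

lemma (in bilinear_algebra) mult_add_right: "mult x (y + z) = mult x y + mult x z"
  using linear_right[of x] by (simp add: Vector_Spaces.linear_iff)

lemma (in bilinear_algebra) mult_add_left: "mult (x + y) z = mult x z + mult y z"
  using linear_left[of z] by (simp add: Vector_Spaces.linear_iff)

lemma (in bilinear_algebra) bilinear_anticommutator:
  "bilinear_algebra scale (anticommutator mult)"
proof -
  interpret vector_space_pair scale scale ..
  have "Vector_Spaces.linear scale scale (\<lambda>y. anticommutator mult x y)"
    and "Vector_Spaces.linear scale scale (\<lambda>y. anticommutator mult y x)" for x
    by (simp_all add: anticommutator_def linear_compose_add linear_left linear_right)
  then show ?thesis
    by (simp add: bilinear_algebra_def bilinear_algebra_axioms_def vector_space_axioms)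
qed

text \<open>
  Sort the words of the left side by their last letter. In the defect \<open>P\<close> formed from the words
  ending in \<open>x\<close>, \<open>y\<close> or \<open>z\<close>, it is always \<open>u\<close> that takes the distinguished middle position: the
  cubic words come from \<open>((x \<circ> y) \<circ> u) \<circ> z\<close> and its cyclic shifts, where \<open>u\<close> is the third letter to
  be multiplied in, so that it stands between the other two in each word such as \<open>x \<cdot> (u \<cdot> (y \<cdot> z))\<close>.
\<close>

lemma (in bilinear_algebra) jordan_defect_decomposition:
  "jordan_defect (anticommutator mult) x y z u =
     commutator_defect mult x y z u + pre_jordan_defect mult x u y z
     + pre_jordan_defect mult y u z x + pre_jordan_defect mult z u x y"
  by (simp add: jordan_defect_def commutator_defect_def pre_jordan_defect_def anticommutator_def
      Let_def mult_add_left mult_add_right algebra_simps)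

lemma (in vector_space) six_torsion_free:
  fixes v :: 'b
  assumes "(6::'a) \<noteq> 0" and "v + v + v + v + v + v = 0"
  shows "v = 0"
proof -
  have "scale 6 v = scale (1 + 1 + 1 + 1 + 1 + 1) v" by simp
  also have "\<dots> = 0" unfolding scale_left_distrib scale_one by (rule assms)
  finally show ?thesis using assms(1) by simp
qed

text \<open>
  The linearized defect is symmetric and additive in \<open>x\<close>, \<open>y\<close>, \<open>z\<close>, and on the diagonal it is three
  times the defect of the Jordan identity. Restricting to the diagonal therefore costs a division by
  \<open>3\<close>, and recovering a symmetric trilinear map from its diagonal a division by \<open>3! = 6\<close>.
\<close>

lemma (in bilinear_algebra) jordan_identity_iff_linearized:
  assumes six: "(6::'k) \<noteq> 0"
    and comm: "\<And>x y. mult x y = mult y x"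
  shows "(\<forall>x y. mult (mult (mult x x) y) x = mult (mult x x) (mult y x)) \<longleftrightarrow>
    (\<forall>x y z u. jordan_defect mult x y z u = 0)"
    (is "?identity \<longleftrightarrow> ?linearized")
proof -
  let ?J = "\<lambda>x y z u. jordan_defect mult x y z u"
  let ?w = "\<lambda>x y. mult (mult x x) (mult y x) - mult (mult (mult x x) y) x"
  have diagonal: "?J x x x y = ?w x y + ?w x y + ?w x y" for x y
    by (simp add: jordan_defect_def comm[of x y])
  have symmetric: "?J y x z u = ?J x y z u" "?J x z y u = ?J x y z u" for x y z u
    by (simp_all add: jordan_defect_def comm algebra_simps)
  have additive: "?J (a + b) y z u = ?J a y z u + ?J b y z u" for a b y z u
    by (simp add: jordan_defect_def mult_add_left mult_add_right algebra_simps)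
  have additive2: "?J y (a + b) z u = ?J y a z u + ?J y b z u"
    and additive3: "?J y z (a + b) u = ?J y z a u + ?J y z b u" for a b y z u
    by (metis additive symmetric)+
  show ?thesis
  proof
    assume ?identity
    then have zero: "?J x x x u = 0" for x u by (simp add: diagonal)
    have "?J x y z u = 0" for x y z u
    proof (rule six_torsion_free[OF six])
      \<comment> \<open>Inclusion-exclusion on the sum \<open>x + y + z\<close> leaves the six arrangements of \<open>x, y, z\<close>.\<close>
      let ?j = "?J x y z u"
      have "?j + ?j + ?j + ?j + ?j + ?j =
          ?J (x + y + z) (x + y + z) (x + y + z) u
          - ?J (x + y) (x + y) (x + y) u - ?J (y + z) (y + z) (y + z) u
          - ?J (x + z) (x + z) (x + z) u + ?J x x x u + ?J y y y u + ?J z z z u"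
        by (simp add: additive additive2 additive3 symmetric algebra_simps)
      also have "\<dots> = 0" by (simp only: zero) simp
      finally show "?j + ?j + ?j + ?j + ?j + ?j = 0" .
    qed
    then show ?linearized by simp
  next
    assume ?linearized
    then have three: "?w x y + ?w x y + ?w x y = 0" for x y
      using diagonal[of x y] by simp
    have "?w x y = 0" for x y
    proof (rule six_torsion_free[OF six])
      show "?w x y + ?w x y + ?w x y + ?w x y + ?w x y + ?w x y = 0"
        using three[of x y] by (simp add: add.assoc)
    qed
    then show ?identity by simp
  qed
qed

theorem corollary2p6:
  fixes scale :: "complex \<Rightarrow> 'a::ab_group_add \<Rightarrow> 'a"
    and mult :: "'a \<Rightarrow> 'a \<Rightarrow> 'a" (infixl "\<cdot>" 70)
    and circ :: "'a \<Rightarrow> 'a \<Rightarrow> 'a" (infixl "\<circ>\<^sub>J" 70)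
  defines "circ \<equiv> anticommutator mult"
  assumes "bilinear_algebra scale mult"
    and "\<And>x y z u.
      (x \<circ>\<^sub>J y) \<cdot> (z \<cdot> u) + (y \<circ>\<^sub>J z) \<cdot> (x \<cdot> u) + (z \<circ>\<^sub>J x) \<cdot> (y \<cdot> u)
      = x \<cdot> (y \<cdot> (z \<cdot> u)) + z \<cdot> (y \<cdot> (x \<cdot> u)) + ((x \<circ>\<^sub>J z) \<circ>\<^sub>J y) \<cdot> u"
  shows "pre_jordan_algebra scale mult \<longleftrightarrow> jordan_algebra scale circ"
proof -
  interpret A: bilinear_algebra scale mult by fact
  interpret C: bilinear_algebra scale circ
    unfolding circ_def by (rule A.bilinear_anticommutator)
  have comm: "x \<circ>\<^sub>J y = y \<circ>\<^sub>J x" for x y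
    by (simp add: circ_def anticommutator_def add.commute)
  have "pre_jordan_defect mult x y z u = 0" for x y z u
    using assms(3)[of x y z u] by (simp add: pre_jordan_defect_def circ_def)
  then have J_eq_Q: "jordan_defect circ x y z u = commutator_defect mult x y z u" for x y z u
    by (simp add: circ_def A.jordan_defect_decomposition)
  have "pre_jordan_algebra scale mult \<longleftrightarrow> (\<forall>x y z u. commutator_defect mult x y z u = 0)"
    using A.bilinear_algebra_axioms assms(3)
    by (auto simp: pre_jordan_algebra_def pre_jordan_algebra_axioms_def commutator_defect_def
        circ_def Let_def diff_diff_eq)
  also have "\<dots> \<longleftrightarrow> (\<forall>x y z u. jordan_defect circ x y z u = 0)"
    by (simp add: J_eq_Q)
  also have "\<dots> \<longleftrightarrow> (\<forall>x y. ((x \<circ>\<^sub>J x) \<circ>\<^sub>J y) \<circ>\<^sub>J x = (x \<circ>\<^sub>J x) \<circ>\<^sub>J (y \<circ>\<^sub>J x))"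
    by (rule C.jordan_identity_iff_linearized[symmetric]) (simp_all add: comm)
  also have "\<dots> \<longleftrightarrow> jordan_algebra scale circ"
    using C.bilinear_algebra_axioms comm
    by (auto simp: jordan_algebra_def jordan_algebra_axioms_def)
  finally show ?thesis .
qed

end
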